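(* Let $n_1 < n_2 < n_3$ be positive integers with $\gcd(n_1,n_2,n_3)=1$, and let $S = \langle n_1,n_2,n_3\rangle$ be the numerical semigroup they generate. For $n \in S$ let $\mu(n)$ be the mean factorization length of $n$. Then $$\lim_{n\to\infty} \frac{\mu(n)}{n} = \frac{1}{3}\left(\frac{1}{n_1}+\frac{1}{n_2}+\frac{1}{n_3}\right),$$ where the limit is taken over $n\in S$.
   Context: $\mathbb{N}$ denotes the nonnegative integers. $S = \langle n_1,n_2,n_3\rangle = \{a_1n_1+a_2n_2+a_3n_3 : a_1,a_2,a_3\in\mathbb{N}\}$, which has finite complement in $\mathbb{N}$. It is not assumed that $n_1,n_2,n_3$ minimally generate $S$. For $n\in S$, a factorization of $n$ is a triple $a=(a_1,a_2,a_3)\in\mathbb{N}^3$ with $n = a_1n_1+a_2n_2+a_3n_3$; its length is $|a| = a_1+a_2+a_3$. The length multiset of $n$ is the multiset of lengths of all factorizations of $n$ (each factorization contributes one entry). The mean factorization length $\mu(n)$ is the average of the length multiset, i.e. the sum of the lengths of all factorizations of $n$ divided by the number of factorizations of $n$. *)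

theory Defs
  imports Complex_Main "HOL-Library.Multiset"
begin

definition semigroup3 :: "nat \<Rightarrow> nat \<Rightarrow> nat \<Rightarrow> nat set" where
  "semigroup3 n1 n2 n3 = {a1 * n1 + a2 * n2 + a3 * n3 | a1 a2 a3. True}"

definition factorizations :: "nat \<Rightarrow> nat \<Rightarrow> nat \<Rightarrow> nat \<Rightarrow> (nat \<times> nat \<times> nat) set" where
  "factorizations n1 n2 n3 n = {(a1, a2, a3). n = a1 * n1 + a2 * n2 + a3 * n3}"

definition fact_length :: "nat \<times> nat \<times> nat \<Rightarrow> nat" where
  "fact_length = (\<lambda>(a1, a2, a3). a1 + a2 + a3)"

(* mset_set is empty on infinite sets; finite_factorizations below rules this
   out for positive generators. *)
definition length_mset :: "nat \<Rightarrow> nat \<Rightarrow> nat \<Rightarrow> nat \<Rightarrow> nat multiset" where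
  "length_mset n1 n2 n3 n = image_mset fact_length (mset_set (factorizations n1 n2 n3 n))"

definition mean_length :: "nat \<Rightarrow> nat \<Rightarrow> nat \<Rightarrow> nat \<Rightarrow> real" where
  "mean_length n1 n2 n3 n =
     real (sum_mset (length_mset n1 n2 n3 n)) / real (size (length_mset n1 n2 n3 n))"

lemma finite_factorizations:
  assumes "n1 > 0" "n2 > 0" "n3 > 0"
  shows "finite (factorizations n1 n2 n3 n)"
proof (rule finite_subset)
  show "factorizations n1 n2 n3 n \<subseteq> {..n} \<times> {..n} \<times> {..n}"
  proof
    fix x assume "x \<in> factorizations n1 n2 n3 n"
    then obtain a b c where x: "x = (a, b, c)" and "n = a * n1 + b * n2 + c * n3"
      by (auto simp: factorizations_def)
    note this(2)
    moreover have "a \<le> a * n1" "b \<le> b * n2" "c \<le> c * n3"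
      using assms by simp_all
    ultimately have "a \<le> n" "b \<le> n" "c \<le> n"
      by linarith+
    then show "x \<in> {..n} \<times> {..n} \<times> {..n}"
      by (simp add: x)
  qed
qed simp

end

theory Submission
  imports Defs
begin

text \<open>Let \<open>F n\<close> be the number of factorizations of \<open>n\<close>. Translating by an integer vector of value
  \<open>k\<close> (Bezout) matches the factorizations of \<open>n\<close> and \<open>n + k\<close> up to \<open>O(n)\<close> exceptions, so \<open>F\<close> varies
  slowly; its sum over a window of length \<open>n3\<close> counts the pairs with \<open>a1 n1 + a2 n2\<close> below the upper
  end of the window. Hence \<open>F n = c n\<^sup>2 + O(n)\<close> with \<open>c > 0\<close>. The sum \<open>A\<close> of the first coordinates satisfies
  \<open>A (n + n1) = A n + F n\<close>, which gives \<open>A n = c n\<^sup>3 / (3 n1) + O(n\<^sup>2)\<close>, and likewise for the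
  other coordinates. Dividing, \<open>c\<close> cancels.\<close>

section \<open>Growth bounds from increments\<close>

text \<open>Increments of order \<open>n ^ j\<close> accumulate along each residue class modulo
  \<open>q\<close> over about \<open>n / q\<close> steps, which raises the order by one. Applied to
  the error term of an exact recurrence, this yields an asymptotic formula.\<close>

lemma polynomial_growth_from_step:
  fixes e :: "nat \<Rightarrow> real"
  assumes "0 < q" and "0 \<le> L"
    and step: "\<And>n. \<bar>e (n + q) - e n\<bar> \<le> L * (real n + 1) ^ j"
  shows "\<exists>M. \<forall>n. \<bar>e n\<bar> \<le> M * (real n + 1) ^ Suc j"
proof -
  \<comment> \<open>\<open>M\<close> has to dominate \<open>L\<close> for the inductive step and all
    starting values \<open>e i\<close> with \<open>i < q\<close> for the base.\<close>
  define M where "M = L + (\<Sum>i<q. \<bar>e i\<bar>)"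
  have M: "L \<le> M" "0 \<le> M"
    using \<open>0 \<le> L\<close> by (auto simp: M_def sum_nonneg)
  have "\<bar>e n\<bar> \<le> M * (real n + 1) ^ Suc j" for n
  proof (induction n rule: less_induct)
    case (less n)
    show ?case
    proof (cases "n < q")
      case True
      then have "\<bar>e n\<bar> \<le> (\<Sum>i<q. \<bar>e i\<bar>)"
        by (intro member_le_sum) auto
      also have "\<dots> \<le> M * 1"
        using \<open>0 \<le> L\<close> by (simp add: M_def)
      also have "\<dots> \<le> M * (real n + 1) ^ Suc j"
        using M by (intro mult_left_mono one_le_power) auto
      finally show ?thesis .
    next
      case False
      define m where "m = n - q"
      have n: "n = m + q" "m < n"
        using False \<open>0 < q\<close> by (auto simp: m_def)
      have "\<bar>e n\<bar> \<le> \<bar>e m\<bar> + L * (real m + 1) ^ j"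
        using step[of m] n by auto
      also have "\<dots> \<le> M * (real m + 1) ^ Suc j + M * (real m + 1) ^ j"
        using less[OF n(2)] M by (intro add_mono mult_right_mono) auto
      also have "\<dots> = M * ((real m + 2) * (real m + 1) ^ j)"
        by (simp add: algebra_simps)
      \<comment> \<open>Since \<open>q\<close> is at least 1, \<open>m + 2\<close> is at most
        \<open>n + 1\<close>.\<close>
      also have "\<dots> \<le> M * ((real n + 1) * (real n + 1) ^ j)"
        using n \<open>0 < q\<close> M by (intro mult_left_mono mult_mono power_mono) auto
      finally show ?thesis by simp
    qed
  qed
  then show ?thesis by blast
qed

text \<open>After division by \<open>n ^ Suc j\<close> the error is at most
  \<open>M * (1 + 1 / n) ^ j / n\<close>, which vanishes in the limit.\<close>

lemma leading_coeff_limit: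
  fixes f :: "nat \<Rightarrow> real"
  assumes "\<And>n. \<bar>f n - c * real n ^ Suc j\<bar> \<le> M * (real n + 1) ^ j"
  shows "(\<lambda>n. f n / real n ^ Suc j) \<longlonglongrightarrow> c"
proof -
  have "(\<lambda>n. f n / real n ^ Suc j - c) \<longlonglongrightarrow> 0"
  proof (rule tendsto_0_le[where K = 1])
    have "(\<lambda>n. M * (1 + 1 / real n) ^ j * (1 / real n)) \<longlonglongrightarrow> M * (1 + 0) ^ j * 0"
      by (intro tendsto_intros lim_1_over_n)
    then show "(\<lambda>n. M * (1 + 1 / real n) ^ j * (1 / real n)) \<longlonglongrightarrow> 0"
      by simp
    show "\<forall>\<^sub>F n in sequentially.
        norm (f n / real n ^ Suc j - c) \<le> norm (M * (1 + 1 / real n) ^ j * (1 / real n)) * 1"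
      using eventually_gt_at_top[of 0]
    proof eventually_elim
      case (elim n)
      have "norm (f n / real n ^ Suc j - c) = \<bar>f n - c * real n ^ Suc j\<bar> / real n ^ Suc j"
        using elim by (simp add: abs_if field_simps)
      also have "\<dots> \<le> M * (real n + 1) ^ j / real n ^ Suc j"
        using assms by (intro divide_right_mono) auto
      also have "\<dots> = M * ((real n + 1) / real n) ^ j * (1 / real n)"
        by (simp add: power_divide)
      also have "(real n + 1) / real n = 1 + 1 / real n"
        using elim by (simp add: field_simps)
      finally show ?case unfolding mult_1_right real_norm_def by linarith
    qed
  qed
  then show ?thesis by (simp add: LIM_zero_iff)
qed

section \<open>Coordinate swaps and factorizations with a small coordinate\<close>

lemma mem_factorizations:
  "(a, b, c) \<in> factorizations p q r n \<longleftrightarrow> n = a * p + b * q + c * r"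
  by (simp add: factorizations_def)

text \<open>This swap and the next one turn sums of second and third coordinates into sums of first
  coordinates.\<close>

lemma factorizations_swap12:
  "factorizations q p r n = (\<lambda>(a, b, c). (b, a, c)) ` factorizations p q r n"
  by (force simp: factorizations_def image_iff)

lemma factorizations_swap13:
  "factorizations r q p n = (\<lambda>(a, b, c). (c, b, a)) ` factorizations p q r n"
  by (force simp: factorizations_def image_iff)

text \<open>Two coordinates determine the third, and the second is at most \<open>n\<close>. Such a
  slab is thus negligible against a total of order \<open>n ^ 2\<close>.\<close>

lemma card_factorizations_first_small:
  assumes "0 < p" "0 < q" "0 < r"
  shows "card {x \<in> factorizations p q r n. fst x < w} \<le> w * (n + 1)"
proof -
  have "inj_on (\<lambda>(a, b, c). (a, b)) {x \<in> factorizations p q r n. fst x < w}"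
    using assms by (intro inj_onI) (auto simp: mem_factorizations)
  moreover have "(\<lambda>(a, b, c). (a, b)) ` {x \<in> factorizations p q r n. fst x < w} \<subseteq> {..<w} \<times> {..n}"
  proof clarsimp
    fix a b c assume "(a, b, c) \<in> factorizations p q r n"
    then have "b * q \<le> n" by (simp add: mem_factorizations)
    moreover have "b \<le> b * q" using assms by simp
    ultimately show "b \<le> n" by linarith
  qed
  ultimately have "card {x \<in> factorizations p q r n. fst x < w} \<le> card ({..<w} \<times> {..n})"
    by (intro card_inj_on_le) auto
  then show ?thesis by simp
qed

lemma card_factorizations_second_small:
  assumes "0 < p" "0 < q" "0 < r"
  shows "card {x \<in> factorizations p q r n. fst (snd x) < w} \<le> w * (n + 1)"
proof -
  have "{x \<in> factorizations p q r n. fst (snd x) < w}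
      = (\<lambda>(a, b, c). (b, a, c)) ` {x \<in> factorizations q p r n. fst x < w}"
    by (force simp: factorizations_def image_iff)
  then have "card {x \<in> factorizations p q r n. fst (snd x) < w}
      \<le> card {x \<in> factorizations q p r n. fst x < w}"
    using assms by (auto intro!: card_image_le finite_factorizations)
  also have "\<dots> \<le> w * (n + 1)"
    using assms by (intro card_factorizations_first_small) auto
  finally show ?thesis .
qed

lemma card_factorizations_third_small:
  assumes "0 < p" "0 < q" "0 < r"
  shows "card {x \<in> factorizations p q r n. snd (snd x) < w} \<le> w * (n + 1)"
proof -
  have "{x \<in> factorizations p q r n. snd (snd x) < w}
      = (\<lambda>(a, b, c). (c, b, a)) ` {x \<in> factorizations r q p n. fst x < w}"
    by (force simp: factorizations_def image_iff)
  then have "card {x \<in> factorizations p q r n. snd (snd x) < w}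
      \<le> card {x \<in> factorizations r q p n. fst x < w}"
    using assms by (auto intro!: card_image_le finite_factorizations)
  also have "\<dots> \<le> w * (n + 1)"
    using assms by (intro card_factorizations_first_small) auto
  finally show ?thesis .
qed

section \<open>Slow variation of the number of factorizations\<close>

text \<open>Translation by \<open>u - w\<close> maps the factorizations of \<open>m\<close> dominating \<open>w\<close> injectively to
  factorizations of \<open>m'\<close>; the others lie on boundedly many planes.\<close>

lemma card_factorizations_shift:
  assumes pos: "0 < p" "0 < q" "0 < r"
    and shift: "w1 * p + w2 * q + w3 * r + m' = u1 * p + u2 * q + u3 * r + m"
  shows "card (factorizations p q r m)
    \<le> card (factorizations p q r m') + (w1 + w2 + w3) * (m + 1)"
proof -
  let ?X = "factorizations p q r m"
  let ?D = "{(a, b, c). (a, b, c) \<in> ?X \<and> w1 \<le> a \<and> w2 \<le> b \<and> w3 \<le> c}"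
  let ?B1 = "{x \<in> ?X. fst x < w1}" and ?B2 = "{x \<in> ?X. fst (snd x) < w2}"
    and ?B3 = "{x \<in> ?X. snd (snd x) < w3}"
  let ?t = "\<lambda>(a, b, c). (a - w1 + u1, b - w2 + u2, c - w3 + u3)"
  have fin: "finite ?X" using pos by (rule finite_factorizations)
  have "card ?D \<le> card (factorizations p q r m')"
  proof (rule card_inj_on_le[where f = ?t])
    show "inj_on ?t ?D" by (intro inj_onI) auto
    show "?t ` ?D \<subseteq> factorizations p q r m'"
    proof clarify
      fix a b c assume "(a, b, c) \<in> ?X" "w1 \<le> a" "w2 \<le> b" "w3 \<le> c"
      \<comment> \<open>Writing the coordinates as sums removes the truncated subtraction from the
        goal.\<close>
      moreover from this obtain a' b' c' where "a = w1 + a'" "b = w2 + b'" "c = w3 + c'"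
        by (auto simp: le_iff_add)
      ultimately show "(a - w1 + u1, b - w2 + u2, c - w3 + u3) \<in> factorizations p q r m'"
        using shift by (simp add: mem_factorizations algebra_simps)
    qed
    show "finite (factorizations p q r m')" using pos by (rule finite_factorizations)
  qed
  moreover have "card ?X \<le> card (?D \<union> (?B1 \<union> (?B2 \<union> ?B3)))"
    using fin by (intro card_mono) (auto intro: finite_subset[of _ ?X])
  moreover have "card (?D \<union> (?B1 \<union> (?B2 \<union> ?B3))) \<le> card ?D + (card ?B1 + (card ?B2 + card ?B3))"
    by (intro order_trans[OF card_Un_le] add_left_mono order_refl)
  moreover have "card ?B1 \<le> w1 * (m + 1)" "card ?B2 \<le> w2 * (m + 1)" "card ?B3 \<le> w3 * (m + 1)"
    using pos by (intro card_factorizations_first_small card_factorizations_second_small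
        card_factorizations_third_small; simp)+
  ultimately show ?thesis by (simp add: algebra_simps)
qed

text \<open>Bezout is applied to \<open>p\<close>, \<open>q\<close> and then to
  \<open>gcd p q\<close>, \<open>r\<close>. Keeping the negative terms on the right gives an integer
  vector \<open>(u, -v, -w)\<close> of value 1 without leaving the naturals.\<close>

lemma bezout_three_nat:
  fixes p q r :: nat
  assumes "0 < p" and "gcd (gcd p q) r = 1"
  shows "\<exists>u v w. u * p = v * q + w * r + 1"
proof -
  obtain x y where xy: "p * x = q * y + gcd p q"
    using bezout_nat[of p q] assms(1) by auto
  obtain s t where st: "gcd p q * s = r * t + 1"
    using bezout_nat[of "gcd p q" r] assms by auto
  have "(x * s) * p = (y * s) * q + t * r + 1"
  proof -
    have "(x * s) * p = (p * x) * s" by simp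
    also have "\<dots> = (y * s) * q + gcd p q * s" unfolding xy by (simp add: algebra_simps)
    finally show ?thesis unfolding st by (simp add: algebra_simps)
  qed
  then show ?thesis by blast
qed

text \<open>The Bezout vector scaled by \<open>k\<close> has value \<open>k\<close>; translating by
  it and by its negative gives the two inequalities. Restricting to \<open>k < r\<close> keeps the
  constant uniform over one window.\<close>

lemma card_factorizations_slowly_varying:
  assumes pos: "0 < p" "0 < q" "0 < r" and "gcd (gcd p q) r = 1"
  shows "\<exists>C \<ge> 0. \<forall>n. \<forall>k < r.
    \<bar>real (card (factorizations p q r (n + k))) - real (card (factorizations p q r n))\<bar>
      \<le> C * (real n + 1)"
proof -
  let ?F = "\<lambda>n. card (factorizations p q r n)"
  obtain u v w where bez: "u * p = v * q + w * r + 1"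
    using bezout_three_nat[OF pos(1) assms(4)] by blast
  \<comment> \<open>Here \<open>r\<close> bounds the scaling factor \<open>k\<close>,
    \<open>u + v + w\<close> bounds the coordinates lost in either direction, and
    \<open>r + 1\<close> absorbs the passage from \<open>n + k + 1\<close> to
    \<open>n + 1\<close>.\<close>
  define C where "C = r * (u + v + w) * (r + 1)"
  have "\<bar>real (?F (n + k)) - real (?F n)\<bar> \<le> real C * (real n + 1)" if "k < r" for n k
  proof -
    have kb: "(k * u) * p = (k * v) * q + (k * w) * r + k"
      using arg_cong[OF bez, of "\<lambda>x. k * x"] by (simp add: algebra_simps)
    have bound: "k * s * (m + 1) \<le> C * (n + 1)" if "m \<le> n + k" "s \<le> u + v + w" for s m
    proof -
      have "m + 1 \<le> n + 1 + r" using that \<open>k < r\<close> by simp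
      also have "\<dots> \<le> (r + 1) * (n + 1)" by simp
      finally have "k * s * (m + 1) \<le> r * (u + v + w) * ((r + 1) * (n + 1))"
        using that \<open>k < r\<close> by (intro mult_mono) auto
      then show ?thesis by (simp only: C_def mult.assoc)
    qed
    \<comment> \<open>Going up decreases only the second and third coordinates; going down, treated
      next, decreases only the first.\<close>
    have "?F n \<le> ?F (n + k) + (0 + k * v + k * w) * (n + 1)"
      by (rule card_factorizations_shift[OF pos, where ?u1.0 = "k * u" and ?u2.0 = 0 and ?u3.0 = 0])
        (use kb in simp)
    also have "(0 + k * v + k * w) * (n + 1) \<le> C * (n + 1)"
      using bound[of n "v + w"] by (simp add: algebra_simps)
    finally have 1: "?F n \<le> ?F (n + k) + C * (n + 1)" by simp
    have "?F (n + k) \<le> ?F n + (k * u + 0 + 0) * (n + k + 1)"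
      by (rule card_factorizations_shift[OF pos,
            where ?u1.0 = 0 and ?u2.0 = "k * v" and ?u3.0 = "k * w"])
        (use kb in simp)
    also have "(k * u + 0 + 0) * (n + k + 1) \<le> C * (n + 1)"
      using bound[of "n + k" u] by simp
    finally have 2: "?F (n + k) \<le> ?F n + C * (n + 1)" by simp
    have "real (?F n) \<le> real (?F (n + k)) + real C * (real n + 1)"
      using of_nat_mono[OF 1, where 'a = real] by (simp add: algebra_simps)
    moreover have "real (?F (n + k)) \<le> real (?F n) + real C * (real n + 1)"
      using of_nat_mono[OF 2, where 'a = real] by (simp add: algebra_simps)
    ultimately show ?thesis by linarith
  qed
  then show ?thesis by (intro exI[of _ "real C"]) auto
qed

section \<open>Counting through windows and lattice points of a triangle\<close>

text \<open>These are the lattice points of a triangle of area \<open>n ^ 2 / (2 * p * q)\<close>;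
  the strict inequality suits half-open windows.\<close>

definition pairs_below :: "nat \<Rightarrow> nat \<Rightarrow> nat \<Rightarrow> (nat \<times> nat) set" where
  "pairs_below p q n = {(a, b). a * p + b * q < n}"

lemma finite_pairs_below:
  assumes "0 < p" "0 < q"
  shows "finite (pairs_below p q n)"
proof (rule finite_subset)
  show "pairs_below p q n \<subseteq> {..n} \<times> {..n}"
  proof (clarsimp simp: pairs_below_def)
    fix a b assume "a * p + b * q < n"
    moreover have "a \<le> a * p" "b \<le> b * q" using assms by simp_all
    ultimately show "a \<le> n \<and> b \<le> n" by linarith
  qed
qed simp

text \<open>Given the first two coordinates, exactly one third coordinate puts the value into a window
  of length \<open>r\<close>.\<close>

lemma sum_card_factorizations_window:
  assumes pos: "0 < p" "0 < q" "0 < r"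
  shows "(\<Sum>k<r. card (factorizations p q r (n + k))) = card (pairs_below p q (n + r))"
proof -
  let ?U = "\<Union>k<r. factorizations p q r (n + k)"
  have "(\<Sum>k<r. card (factorizations p q r (n + k))) = card ?U"
    by (rule card_UN_disjoint[symmetric])
      (use finite_factorizations[OF pos] in \<open>auto simp: mem_factorizations\<close>)
  also have "\<dots> = card (pairs_below p q (n + r))"
  proof (rule bij_betw_same_card[of "\<lambda>(a, b, c). (a, b)"], rule bij_betw_imageI)
    have U: "(a, b, c) \<in> ?U \<longleftrightarrow> n \<le> a * p + b * q + c * r \<and> a * p + b * q + c * r < n + r" for a b c
    proof
      assume R: "n \<le> a * p + b * q + c * r \<and> a * p + b * q + c * r < n + r"
      then show "(a, b, c) \<in> ?U"
        by (intro UN_I[of "a * p + b * q + c * r - n"]) (auto simp: mem_factorizations)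
    qed (auto simp: mem_factorizations)
    show "inj_on (\<lambda>(a, b, c). (a, b)) ?U"
    proof (rule inj_onI)
      fix x y assume xy: "x \<in> ?U" "y \<in> ?U"
        and eq: "(\<lambda>(a, b, c). (a, b)) x = (\<lambda>(a, b, c). (a, b)) y"
      from eq obtain a b c d where *: "x = (a, b, c)" "y = (a, b, d)"
        by (cases x, cases y) auto
      from xy have "n \<le> a * p + b * q + c * r" "a * p + b * q + c * r < n + r"
        "n \<le> a * p + b * q + d * r" "a * p + b * q + d * r < n + r"
        unfolding * U by auto
      \<comment> \<open>Two values in a window of length \<open>r\<close> differ by less than
        \<open>r\<close>.\<close>
      then have "c * r < (d + 1) * r" "d * r < (c + 1) * r" by (simp_all add: algebra_simps)
      then have "c < d + 1" "d < c + 1" by (simp_all only: mult_less_cancel2)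
      then show "x = y" using * by simp
    qed
    show "(\<lambda>(a, b, c). (a, b)) ` ?U = pairs_below p q (n + r)"
    proof (intro equalityI subsetI)
      fix x assume "x \<in> (\<lambda>(a, b, c). (a, b)) ` ?U"
      then obtain a b c where "x = (a, b)" "(a, b, c) \<in> ?U" by auto
      then show "x \<in> pairs_below p q (n + r)"
        unfolding U by (auto simp: pairs_below_def)
    next
      fix x assume "x \<in> pairs_below p q (n + r)"
      then obtain a b where x: "x = (a, b)" and s: "a * p + b * q < n + r"
        by (auto simp: pairs_below_def)
      \<comment> \<open>The largest \<open>c\<close> whose value is at most
        \<open>n + r - 1\<close>, the last point of the window; by maximality the value is at least
        \<open>n\<close>.\<close>
      define c where "c = (n + r - 1 - (a * p + b * q)) div r"
      have "c * r + (n + r - 1 - (a * p + b * q)) mod r = n + r - 1 - (a * p + b * q)"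
        by (simp add: c_def)
      moreover have "(n + r - 1 - (a * p + b * q)) mod r < r" using pos by simp
      ultimately have "(a, b, c) \<in> ?U"
        unfolding U using s by linarith
      then show "x \<in> (\<lambda>(a, b, c). (a, b)) ` ?U"
        unfolding x by force
    qed
  qed
  finally show ?thesis .
qed

text \<open>The count is exactly the ceiling of \<open>n / q\<close>.\<close>

lemma card_multiples_below:
  assumes "0 < q"
  shows "\<bar>real (card {b. b * q < n}) - real n / real q\<bar> \<le> 1"
proof -
  have "{b. b * q < n} = {..<nat \<lceil>real n / real q\<rceil>}"
  proof (intro set_eqI)
    fix b
    have "b * q < n \<longleftrightarrow> real b * real q < real n"
      by (metis of_nat_less_iff of_nat_mult)
    also have "\<dots> \<longleftrightarrow> real b < real n / real q"
      using assms by (simp add: field_simps)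
    also have "\<dots> \<longleftrightarrow> b < nat \<lceil>real n / real q\<rceil>"
      by linarith
    finally show "b \<in> {b. b * q < n} \<longleftrightarrow> b \<in> {..<nat \<lceil>real n / real q\<rceil>}" by simp
  qed
  moreover have "0 \<le> real n / real q" by simp
  ultimately show ?thesis by simp linarith
qed

text \<open>Pairs with positive first coordinate come from pairs below \<open>n\<close> by adding 1
  to it; the remaining pairs have first coordinate 0.\<close>

lemma card_pairs_below_step:
  assumes "0 < p" "0 < q"
  shows "card (pairs_below p q (n + p)) = card (pairs_below p q n) + card {b. b * q < n + p}"
proof -
  let ?S = "(\<lambda>(a, b). (Suc a, b)) ` pairs_below p q n" and ?Z = "Pair (0::nat) ` {b. b * q < n + p}"
  have eq: "pairs_below p q (n + p) = ?S \<union> ?Z"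
  proof (intro equalityI subsetI)
    fix x assume "x \<in> pairs_below p q (n + p)"
    then obtain a b where "x = (a, b)" "a * p + b * q < n + p" by (auto simp: pairs_below_def)
    then show "x \<in> ?S \<union> ?Z"
      by (cases a) (force simp: pairs_below_def)+
  qed (auto simp: pairs_below_def)
  have "finite ?S" "finite ?Z"
    using finite_pairs_below[OF assms, of "n + p"] unfolding eq finite_Un by blast+
  then have "card (pairs_below p q (n + p)) = card ?S + card ?Z"
    unfolding eq by (intro card_Un_disjoint) auto
  also have "card ?S = card (pairs_below p q n)"
    by (intro card_image inj_onI) auto
  also have "card ?Z = card {b. b * q < n + p}"
    by (intro card_image inj_onI) auto
  finally show ?thesis .
qed

lemma card_pairs_below_asymp:
  assumes "0 < p" "0 < q"
  shows "\<exists>M. \<forall>n. \<bar>real (card (pairs_below p q n)) - real n ^ 2 / (2 * real p * real q)\<bar>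
    \<le> M * (real n + 1)"
proof -
  define e where "e n = real (card (pairs_below p q n)) - real n ^ 2 / (2 * real p * real q)" for n
  \<comment> \<open>The 1 is the rounding error of the ceiling; \<open>p / (2 * q)\<close> is the
    excess of \<open>(n + p) / q\<close> over the increment of
    \<open>n ^ 2 / (2 * p * q)\<close>.\<close>
  define L where "L = 1 + real p / (2 * real q)"
  have "\<bar>e (n + p) - e n\<bar> \<le> L * (real n + 1) ^ 0" for n
  proof -
    have "e (n + p) - e n
        = (real (card {b. b * q < n + p}) - real (n + p) / real q) + real p / (2 * real q)"
      using assms unfolding e_def card_pairs_below_step[OF assms]
      by (simp add: field_simps power2_eq_square)
    moreover have "0 \<le> real p / (2 * real q)" by simp
    ultimately show ?thesis
      using card_multiples_below[OF assms(2), of "n + p"] unfolding L_def power_0 mult_1_right by linarith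
  qed
  moreover have "0 \<le> L" by (simp add: L_def)
  ultimately obtain M where "\<And>n. \<bar>e n\<bar> \<le> M * (real n + 1) ^ Suc 0"
    using polynomial_growth_from_step[OF assms(1)] by blast
  then show ?thesis unfolding e_def by auto
qed

text \<open>By slow variation a window sum is \<open>r\<close> times the count at \<open>n\<close>
  up to a linear error, and it also equals a triangle count of known size.\<close>

lemma card_factorizations_asymp:
  assumes pos: "0 < p" "0 < q" "0 < r" and "gcd (gcd p q) r = 1"
  shows "\<exists>M. \<forall>n. \<bar>real (card (factorizations p q r n))
      - real n ^ 2 / (2 * real p * real q * real r)\<bar> \<le> M * (real n + 1)"
proof -
  let ?F = "\<lambda>n. real (card (factorizations p q r n))"
  obtain C where C: "0 \<le> C" "\<And>n k. k < r \<Longrightarrow> \<bar>?F (n + k) - ?F n\<bar> \<le> C * (real n + 1)"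
    using card_factorizations_slowly_varying[OF assms] by blast
  obtain K where K: "\<And>n. \<bar>real (card (pairs_below p q n)) - real n ^ 2 / (2 * real p * real q)\<bar>
      \<le> K * (real n + 1)"
    using card_pairs_below_asymp[OF pos(1,2)] by blast
  have K0: "0 \<le> K" using K[of 0] by simp
  define t where "t = 2 * real p * real q"
  have t: "0 < t" using pos by (simp add: t_def)
  \<comment> \<open>The three summands bound the variation inside the window, the error of the
    triangle count at \<open>n + r\<close>, and the replacement of \<open>(n + r) ^ 2\<close> by
    \<open>n ^ 2\<close>.\<close>
  define M where "M = (real r * C + K * (real r + 1) + (real r ^ 2 + 2 * real r) / t) / real r"
  have "\<bar>?F n - real n ^ 2 / (t * real r)\<bar> \<le> M * (real n + 1)" for n
  proof -
    let ?H = "real (card (pairs_below p q (n + r)))"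
    have "?H = (\<Sum>k<r. ?F (n + k))"
      unfolding sum_card_factorizations_window[OF pos, symmetric] by simp
    then have "\<bar>?H - real r * ?F n\<bar> = \<bar>\<Sum>k<r. ?F (n + k) - ?F n\<bar>"
      by (simp add: sum_subtractf)
    also have "\<dots> \<le> (\<Sum>k<r. C * (real n + 1))"
      by (intro order_trans[OF sum_abs] sum_mono C) simp
    finally have 1: "\<bar>?H - real r * ?F n\<bar> \<le> real r * C * (real n + 1)" by simp
    have "\<bar>?H - real (n + r) ^ 2 / t\<bar> \<le> K * (real (n + r) + 1)"
      using K[of "n + r"] by (simp add: t_def)
    also have "\<dots> \<le> K * ((real r + 1) * (real n + 1))"
      using K0 by (intro mult_left_mono) (auto simp: algebra_simps)
    finally have 2: "\<bar>?H - real (n + r) ^ 2 / t\<bar> \<le> K * (real r + 1) * (real n + 1)"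
      by (simp add: mult.assoc)
    have "real (n + r) ^ 2 / t - real n ^ 2 / t = (2 * real r * real n + real r ^ 2) / t"
      by (simp add: power2_eq_square algebra_simps add_divide_distrib)
    moreover have "(2 * real r * real n + real r ^ 2) / t
        \<le> ((real r ^ 2 + 2 * real r) * (real n + 1)) / t"
      using t by (intro divide_right_mono) (auto simp: algebra_simps)
    moreover have "0 \<le> (2 * real r * real n + real r ^ 2) / t" using t by simp
    ultimately have "\<bar>real (n + r) ^ 2 / t - real n ^ 2 / t\<bar>
        \<le> (real r ^ 2 + 2 * real r) / t * (real n + 1)" by (simp only: abs_of_nonneg times_divide_eq_left)
    with 1 2 have "\<bar>real r * ?F n - real n ^ 2 / t\<bar> \<le> real r * C * (real n + 1)
        + K * (real r + 1) * (real n + 1) + (real r ^ 2 + 2 * real r) / t * (real n + 1)"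
      by linarith
    also have "\<dots> = real r * (M * (real n + 1))"
      using pos by (simp add: M_def distrib_right)
    finally have "\<bar>real r * ?F n - real n ^ 2 / t\<bar> / real r \<le> M * (real n + 1)"
      using pos by (simp add: divide_le_eq mult.commute)
    moreover have "?F n - real n ^ 2 / (t * real r) = (real r * ?F n - real n ^ 2 / t) / real r"
      using pos t by (simp add: diff_divide_distrib)
    ultimately show ?thesis by simp
  qed
  then show ?thesis unfolding t_def by blast
qed

section \<open>Sums of coordinates\<close>

text \<open>Adding 1 to the first coordinate reaches every factorization of \<open>n + p\<close>
  except those with first coordinate 0, which contribute nothing to the sum.\<close>

lemma sum_fst_factorizations_step:
  assumes pos: "0 < p" "0 < q" "0 < r"
  shows "(\<Sum>x\<in>factorizations p q r (n + p). fst x)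
    = (\<Sum>x\<in>factorizations p q r n. fst x) + card (factorizations p q r n)"
proof -
  let ?s = "\<lambda>(a, b, c). (Suc a, b, c)"
  have "(\<Sum>x\<in>factorizations p q r (n + p). fst x)
      = (\<Sum>x\<in>?s ` factorizations p q r n. fst x)"
  proof (rule sum.mono_neutral_right)
    show "finite (factorizations p q r (n + p))" using pos by (rule finite_factorizations)
    show "?s ` factorizations p q r n \<subseteq> factorizations p q r (n + p)"
      by (auto simp: factorizations_def)
    show "\<forall>x\<in>factorizations p q r (n + p) - ?s ` factorizations p q r n. fst x = 0"
    proof clarify
      fix a b c assume *: "(a, b, c) \<in> factorizations p q r (n + p)"
        "(a, b, c) \<notin> ?s ` factorizations p q r n"
      show "fst (a, b, c) = 0"
        by (cases a) (use * in \<open>force simp: factorizations_def image_iff\<close>)+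
    qed
  qed
  also have "\<dots> = (\<Sum>x\<in>factorizations p q r n. Suc (fst x))"
    by (subst sum.reindex) (auto intro!: inj_onI sum.cong)
  finally show ?thesis by (simp add: sum_Suc)
qed

lemma sum_fst_factorizations_limit:
  assumes pos: "0 < p" "0 < q" "0 < r" and "gcd (gcd p q) r = 1"
  shows "(\<lambda>n. real (\<Sum>x\<in>factorizations p q r n. fst x) / real n ^ 3)
    \<longlonglongrightarrow> 1 / (2 * real p * real q * real r) * (1 / (3 * real p))"
proof -
  define c where "c = 1 / (2 * real p * real q * real r)"
  have c: "0 \<le> c" by (simp add: c_def)
  let ?F = "\<lambda>n. real (card (factorizations p q r n))"
  let ?A = "\<lambda>n. real (\<Sum>x\<in>factorizations p q r n. fst x)"
  obtain K where K: "\<And>n. \<bar>?F n - c * real n ^ 2\<bar> \<le> K * (real n + 1)"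
    using card_factorizations_asymp[OF assms] by (auto simp: c_def)
  have K0: "0 \<le> K" using K[of 0] by simp
  define e where "e n = ?A n - c * (1 / (3 * real p)) * real n ^ 3" for n
  \<comment> \<open>\<open>K\<close> comes from the count; the rest bounds the lower-order part
    \<open>c * (n * p + p ^ 2 / 3)\<close> of the increment of
    \<open>c * n ^ 3 / (3 * p)\<close>.\<close>
  define L where "L = K + c * (real p + real p ^ 2)"
  have "\<bar>e (n + p) - e n\<bar> \<le> L * (real n + 1) ^ 1" for n
  proof -
    have "e (n + p) - e n = (?F n - c * real n ^ 2) - c * (real n * real p + real p ^ 2 / 3)"
      using pos unfolding e_def sum_fst_factorizations_step[OF pos]
      by (simp add: field_simps power2_eq_square power3_eq_cube)
    moreover have "0 \<le> c * (real n * real p + real p ^ 2 / 3)" using c by simp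
    moreover have "c * (real n * real p + real p ^ 2 / 3) \<le> c * ((real p + real p ^ 2) * (real n + 1))"
      using c by (intro mult_left_mono) (auto simp: algebra_simps)
    moreover have "L * (real n + 1) ^ 1
        = K * (real n + 1) + c * ((real p + real p ^ 2) * (real n + 1))"
      by (simp add: L_def algebra_simps)
    ultimately show ?thesis using K[of n] by linarith
  qed
  moreover have "0 \<le> L" using K0 c by (simp add: L_def)
  ultimately obtain M where "\<And>n. \<bar>e n\<bar> \<le> M * (real n + 1) ^ Suc 1"
    using polynomial_growth_from_step[OF pos(1)] by blast
  then have "(\<lambda>n. ?A n / real n ^ Suc 2) \<longlonglongrightarrow> c * (1 / (3 * real p))"
    by (intro leading_coeff_limit[where M = M]) (simp add: e_def numeral_eq_Suc)
  then show ?thesis by (simp add: c_def numeral_3_eq_3 numeral_2_eq_2)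
qed

section \<open>The mean length and its limit\<close>

lemma mean_length_eq:
  "mean_length p q r n
    = real (\<Sum>x\<in>factorizations p q r n. fact_length x) / real (card (factorizations p q r n))"
  by (simp add: mean_length_def length_mset_def sum_unfold_sum_mset)

lemma sum_fact_length:
  "(\<Sum>x\<in>factorizations p q r n. fact_length x)
    = (\<Sum>x\<in>factorizations p q r n. fst x) + (\<Sum>x\<in>factorizations q p r n. fst x)
      + (\<Sum>x\<in>factorizations r q p n. fst x)"
proof -
  have "(\<Sum>x\<in>factorizations q p r n. fst x) = (\<Sum>x\<in>factorizations p q r n. fst (snd x))"
    unfolding factorizations_swap12[of q p]
    by (subst sum.reindex) (auto intro!: inj_onI sum.cong)
  moreover have "(\<Sum>x\<in>factorizations r q p n. fst x) = (\<Sum>x\<in>factorizations p q r n. snd (snd x))"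
    unfolding factorizations_swap13[of r q p]
    by (subst sum.reindex) (auto intro!: inj_onI sum.cong)
  ultimately show ?thesis
    by (auto simp: fact_length_def sum.distrib[symmetric] intro!: sum.cong)
qed

theorem theorem6:
  fixes n1 n2 n3 :: nat
  assumes "0 < n1" and "n1 < n2" and "n2 < n3"
    and "Gcd {n1, n2, n3} = 1"
  shows "((\<lambda>n. mean_length n1 n2 n3 n / real n)
           \<longlongrightarrow> 1 / 3 * (1 / real n1 + 1 / real n2 + 1 / real n3))
         (inf sequentially (principal (semigroup3 n1 n2 n3)))"
\<comment> \<open>The limit is proved along all naturals, a filter coarser than its restriction to
  the semigroup.\<close>
proof (rule tendsto_mono[OF inf_le1])
  have pos: "0 < n1" "0 < n2" "0 < n3" using assms by auto
  have g: "gcd (gcd n1 n2) n3 = 1" "gcd (gcd n2 n1) n3 = 1" "gcd (gcd n3 n2) n1 = 1"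
    using assms(4) by (simp_all add: gcd.assoc gcd.commute gcd.left_commute)
  define c where "c = 1 / (2 * real n1 * real n2 * real n3)"
  have c: "c \<noteq> 0" using pos by (simp add: c_def)
  let ?F = "\<lambda>n. real (card (factorizations n1 n2 n3 n))"
  let ?A = "\<lambda>p q r n. real (\<Sum>x\<in>factorizations p q r n. fst x)"
  obtain K where K: "\<And>n. \<bar>?F n - c * real n ^ 2\<bar> \<le> K * (real n + 1)"
    using card_factorizations_asymp[OF pos g(1)] by (auto simp: c_def)
  have F: "(\<lambda>n. ?F n / real n ^ 2) \<longlonglongrightarrow> c"
    using leading_coeff_limit[of ?F c 1 K] K by (simp add: numeral_2_eq_2)
  have A: "(\<lambda>n. ?A n1 n2 n3 n / real n ^ 3) \<longlonglongrightarrow> c * (1 / (3 * real n1))"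
    "(\<lambda>n. ?A n2 n1 n3 n / real n ^ 3) \<longlonglongrightarrow> c * (1 / (3 * real n2))"
    "(\<lambda>n. ?A n3 n2 n1 n / real n ^ 3) \<longlonglongrightarrow> c * (1 / (3 * real n3))"
    using sum_fst_factorizations_limit[OF pos g(1)]
      sum_fst_factorizations_limit[OF pos(2,1,3) g(2)]
      sum_fst_factorizations_limit[OF pos(3,2,1) g(3)]
    by (simp_all add: c_def mult_ac)
  have "(\<lambda>n. (?A n1 n2 n3 n / real n ^ 3 + ?A n2 n1 n3 n / real n ^ 3
        + ?A n3 n2 n1 n / real n ^ 3) / (?F n / real n ^ 2))
      \<longlonglongrightarrow> (c * (1 / (3 * real n1)) + c * (1 / (3 * real n2)) + c * (1 / (3 * real n3))) / c"
    by (intro tendsto_intros A F c)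
  also have "(c * (1 / (3 * real n1)) + c * (1 / (3 * real n2)) + c * (1 / (3 * real n3))) / c
      = 1 / 3 * (1 / real n1 + 1 / real n2 + 1 / real n3)"
    using c by (simp add: add_divide_distrib distrib_left)
  finally show "(\<lambda>n. mean_length n1 n2 n3 n / real n)
      \<longlonglongrightarrow> 1 / 3 * (1 / real n1 + 1 / real n2 + 1 / real n3)"
  proof (rule Lim_transform_eventually)
    show "\<forall>\<^sub>F n in sequentially.
        (?A n1 n2 n3 n / real n ^ 3 + ?A n2 n1 n3 n / real n ^ 3
          + ?A n3 n2 n1 n / real n ^ 3) / (?F n / real n ^ 2) = mean_length n1 n2 n3 n / real n"
      using eventually_gt_at_top[of 0]
    proof eventually_elim
      case (elim n)
      \<comment> \<open>For \<open>f = 0\<close> both sides are 0 by the convention on division by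
        zero, so the identity also covers an \<open>n\<close> without factorizations.\<close>
      have "(x / real n ^ 3 + y / real n ^ 3 + z / real n ^ 3) / (f / real n ^ 2)
          = (x + y + z) / f / real n" for x y z f
        using elim by (cases "f = 0") (simp_all add: field_simps power2_eq_square power3_eq_cube)
      then show ?case
        unfolding mean_length_eq sum_fact_length of_nat_add .
    qed
  qed
qed

end
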